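(* Suppose there is a function $R:(0,1)\to(0,\infty)$ with $R(h)\to\infty$ as $h\to0$ such that $$\mathbb{E}\sup_{t\in[0,\tau_{R(h),h}]}\|E(t)\|^2\to0\quad\text{as }h\to0 .$$ Suppose moreover that for some monotonically growing function $\varphi:[0,\infty)\to[0,\infty)$ (nondecreasing, with $\varphi(z)\to\infty$ as $z\to\infty$) there is a constant $C$ such that for all $h\in(0,1)$ $$\mathbb{E}\,\varphi\big(\|x(\tau_{R(h),h})\|\big)\le C ,$$ and that for some $q>0$ there is a constant $C$ such that for all $h\in(0,1)$ $$\sup_{t\in[0,T]}\mathbb{E}\|x(t)\|^q+\sup_{t\in[0,T]}\mathbb{E}\|Y(t)\|^q\le C .$$ Then for every $\theta\in(0,q)\cap(0,2]$ $$\lim_{h\searrow0}\ \sup_{t\in[0,T]}\mathbb{E}\|E(t)\|^\theta=0 .$$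
   Context: Fix $T>0$ and dimensions $p,m$. Let $W$ be an $m$-dimensional standard Brownian motion on a filtered probability space. Let $f,f_h:\mathbb{R}^p\to\mathbb{R}^p$ and $g,g_h:\mathbb{R}^p\to\mathbb{R}^{p\times m}$, $h\in(0,1)$, be locally Lipschitz, such that for every $R>0$ there are constants $C_a(R,h),L(R),B(R)$, nondecreasing in $R$, such that for all $u,v$ with norm less than $R$: (1) $\|f_h(u)-f(u)\|\le C_a(R,h)$ and $\|g_h(u)-g(u)\|_{\mathrm{HS}}\le C_a(R,h)$, with $C_a(R,h)\to0$ as $h\to0$; (2) $\|f(u)-f(v)\|\le L(R)\|u-v\|$ and $\|g(u)-g(v)\|_{\mathrm{HS}}\le L(R)\|u-v\|$; (3) $\|f_h(u)\|\le B(R)$ and $\|g_h(u)\|_{\mathrm{HS}}\le B(R)$. Here $\|\cdot\|$ is the Euclidean norm and $\|\cdot\|_{\mathrm{HS}}$ the Hilbert–Schmidt norm. $x$ is the solution on $[0,T]$ of $x(t)=x_0+\int_0^t f(x(s))\,ds+\int_0^t g(x(s))\,dW(s)$. For $h\in(0,1)$ the approximation $Y$ (depending on $h$) is $Y(t)=x_0+\int_0^t f_h(Y(\lfloor s\rfloor))\,ds+\int_0^t g_h(Y(\lfloor s\rfloor))\,dW(s)$, where $\lfloor s\rfloor=\max\{kh\le s: k\in\mathbb{N}_0\}$. The error is $E(t)=x(t)-Y(t)$, and $$\tau_{R,h}=T\wedge\inf\{t>0:\ \|x(t)\|>R-1\ \text{or}\ \|E(t)\|>1\}.$$ *)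

theory Defs
  imports "HOL-Probability.Probability"
begin

text \<open>
  Processes are functions of time and outcome, with the time parameter of type real; only times
  \<open>t \<ge> 0\<close> matter (a filtration on the nonnegative reals extends to the negative reals by
  its value at 0).  No usual conditions are imposed.  A matrix with \<open>p\<close> rows and
  \<open>m\<close> columns has type \<open>real^'m^'p\<close>, on which \<^const>\<open>norm\<close> is the
  Hilbert--Schmidt norm:
\<close>

lemma norm_matrix_HS:
  fixes A :: "real^'m^'p"
  shows "norm A = sqrt (\<Sum>i\<in>UNIV. \<Sum>j\<in>UNIV. (A $ i $ j)\<^sup>2)"
  by (simp add: norm_vec_def L2_set_def sum_nonneg)

definition filtered_prob_space :: "'a measure \<Rightarrow> (real \<Rightarrow> 'a measure) \<Rightarrow> bool" where
  "filtered_prob_space M F \<longleftrightarrow>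
     prob_space M \<and> filtration (space M) F \<and> (\<forall>t. subalgebra M (F t))"

definition standard_brownian_motion ::
  "'a measure \<Rightarrow> (real \<Rightarrow> 'a measure) \<Rightarrow> (real \<Rightarrow> 'a \<Rightarrow> real^'m) \<Rightarrow> bool" where
  "standard_brownian_motion M F W \<longleftrightarrow>
     (\<forall>t\<ge>0. W t \<in> borel_measurable (F t)) \<and>
     (\<forall>\<omega>\<in>space M. continuous_on {0..} (\<lambda>t. W t \<omega>)) \<and>
     (AE \<omega> in M. W 0 \<omega> = 0) \<and>
     (\<forall>s\<ge>0. \<forall>t>s.
        prob_space.indep_set M (sets (F s))
          (sets (vimage_algebra (space M) (\<lambda>\<omega>. W t \<omega> - W s \<omega>) borel)) \<and>
        prob_space.indep_vars M (\<lambda>_. borel) (\<lambda>j \<omega>. (W t \<omega> - W s \<omega>) $ j) UNIV \<and>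
        (\<forall>j. distributed M lborel (\<lambda>\<omega>. (W t \<omega> - W s \<omega>) $ j)
               (normal_density 0 (sqrt (t - s)))))"

text \<open>
  The measurability requirement matters: the measure of a non-measurable set is 0 by convention.
\<close>

definition tendsto_0_in_prob :: "'a measure \<Rightarrow> (nat \<Rightarrow> 'a \<Rightarrow> ennreal) \<Rightarrow> bool" where
  "tendsto_0_in_prob M X \<longleftrightarrow>
     (\<forall>n. X n \<in> borel_measurable M) \<and>
     (\<forall>\<epsilon>>0. (\<lambda>n. measure M {\<omega> \<in> space M. X n \<omega> > ennreal \<epsilon>}) \<longlonglongrightarrow> 0)"

definition progressively_measurable ::
  "(real \<Rightarrow> 'a measure) \<Rightarrow> real \<Rightarrow> (real \<Rightarrow> 'a \<Rightarrow> 'b::topological_space) \<Rightarrow> bool" where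
  "progressively_measurable F T H \<longleftrightarrow>
     (\<forall>t\<in>{0..T}. (\<lambda>(s, \<omega>). H s \<omega>) \<in> borel_measurable (restrict_space borel {0..t} \<Otimes>\<^sub>M F t))"

text \<open>
  \<open>simple_ito_integral M F W T H I\<close>: \<open>H\<close> is a simple process
  \<open>\<Sum>k<n. \<xi>\<^sub>k 1\<^bsub>[t\<^sub>k, t\<^sub>k\<^sub>+\<^sub>1)\<^esub>\<close> with bounded \<open>\<xi>\<^sub>k\<close> measurable at
  time \<open>t\<^sub>k\<close>, and \<open>I\<close> is its elementary stochastic integral process.
\<close>

definition simple_ito_integral ::
  "'a measure \<Rightarrow> (real \<Rightarrow> 'a measure) \<Rightarrow> (real \<Rightarrow> 'a \<Rightarrow> real^'m) \<Rightarrow> real \<Rightarrow>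
   (real \<Rightarrow> 'a \<Rightarrow> real^'m^'p) \<Rightarrow> (real \<Rightarrow> 'a \<Rightarrow> real^'p) \<Rightarrow> bool" where
  "simple_ito_integral M F W T H I \<longleftrightarrow>
     (\<exists>(n::nat) (\<tau>::nat \<Rightarrow> real) \<xi>.
        \<tau> 0 = 0 \<and> \<tau> n = T \<and> (\<forall>k<n. \<tau> k < \<tau> (Suc k)) \<and>
        (\<forall>k<n. \<xi> k \<in> borel_measurable (F (\<tau> k)) \<and> (\<exists>K. \<forall>\<omega>\<in>space M. norm (\<xi> k \<omega>) \<le> K)) \<and>
        H = (\<lambda>s \<omega>. \<Sum>k<n. indicator {\<tau> k..<\<tau> (Suc k)} s *\<^sub>R \<xi> k \<omega>) \<and>
        I = (\<lambda>t \<omega>. \<Sum>k<n. \<xi> k \<omega> *v (W (min (\<tau> (Suc k)) t) \<omega> - W (min (\<tau> k) t) \<omega>)))"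

text \<open>
  \<open>has_ito_integral M F W T H I\<close>: the process \<open>I\<close> is a continuous version of
  \<open>t \<mapsto> \<integral>\<^sub>0\<^sup>t H dW\<close> on \<open>[0, T]\<close>, that is, the limit, uniformly in time in
  probability, of the elementary integrals of simple processes approximating \<open>H\<close>.
\<close>

definition has_ito_integral ::
  "'a measure \<Rightarrow> (real \<Rightarrow> 'a measure) \<Rightarrow> (real \<Rightarrow> 'a \<Rightarrow> real^'m) \<Rightarrow> real \<Rightarrow>
   (real \<Rightarrow> 'a \<Rightarrow> real^'m^'p) \<Rightarrow> (real \<Rightarrow> 'a \<Rightarrow> real^'p) \<Rightarrow> bool" where
  "has_ito_integral M F W T H I \<longleftrightarrow>
     progressively_measurable F T H \<and>
     (AE \<omega> in M. (\<integral>\<^sup>+s\<in>{0..T}. ennreal ((norm (H s \<omega>))\<^sup>2) \<partial>lborel) < \<infinity>) \<and>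
     (\<forall>t\<in>{0..T}. I t \<in> borel_measurable M) \<and>
     (\<forall>\<omega>\<in>space M. continuous_on {0..T} (\<lambda>t. I t \<omega>)) \<and>
     (\<exists>H' I'.
        (\<forall>n. simple_ito_integral M F W T (H' n) (I' n)) \<and>
        tendsto_0_in_prob M
          (\<lambda>n \<omega>. \<integral>\<^sup>+s\<in>{0..T}. ennreal ((norm (H' n s \<omega> - H s \<omega>))\<^sup>2) \<partial>lborel) \<and>
        tendsto_0_in_prob M
          (\<lambda>n \<omega>. SUP t\<in>{0..T}. ennreal (norm (I' n t \<omega> - I t \<omega>))))"

text \<open>
  \<open>is_ito_process M F W T x0 b \<sigma> X\<close>: the process \<open>X\<close> is adapted and continuous on
  \<open>[0, T]\<close> and almost surely satisfies
  \<open>X(t) = x0 + \<integral>\<^sub>0\<^sup>t b(s) ds + \<integral>\<^sub>0\<^sup>t \<sigma>(s) dW(s)\<close> for all \<open>t\<close>.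
\<close>

definition is_ito_process ::
  "'a measure \<Rightarrow> (real \<Rightarrow> 'a measure) \<Rightarrow> (real \<Rightarrow> 'a \<Rightarrow> real^'m) \<Rightarrow> real \<Rightarrow> ('a \<Rightarrow> real^'p) \<Rightarrow>
   (real \<Rightarrow> 'a \<Rightarrow> real^'p) \<Rightarrow> (real \<Rightarrow> 'a \<Rightarrow> real^'m^'p) \<Rightarrow> (real \<Rightarrow> 'a \<Rightarrow> real^'p) \<Rightarrow> bool" where
  "is_ito_process M F W T x0 b \<sigma> X \<longleftrightarrow>
     (\<forall>t\<in>{0..T}. X t \<in> borel_measurable (F t)) \<and>
     (\<forall>\<omega>\<in>space M. continuous_on {0..T} (\<lambda>t. X t \<omega>)) \<and>
     (\<exists>I. has_ito_integral M F W T \<sigma> I \<and>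
        (AE \<omega> in M. \<forall>t\<in>{0..T}.
           set_integrable lborel {0..t} (\<lambda>s. b s \<omega>) \<and>
           X t \<omega> = x0 \<omega> + (LINT s:{0..t}|lborel. b s \<omega>) + I t \<omega>))"

definition grid_floor :: "real \<Rightarrow> real \<Rightarrow> real" where
  "grid_floor h s = Max {real k * h |k::nat. real k * h \<le> s}"

definition sde_solution ::
  "'a measure \<Rightarrow> (real \<Rightarrow> 'a measure) \<Rightarrow> (real \<Rightarrow> 'a \<Rightarrow> real^'m) \<Rightarrow> real \<Rightarrow> ('a \<Rightarrow> real^'p) \<Rightarrow>
   (real^'p \<Rightarrow> real^'p) \<Rightarrow> (real^'p \<Rightarrow> real^'m^'p) \<Rightarrow> (real \<Rightarrow> 'a \<Rightarrow> real^'p) \<Rightarrow> bool" where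
  "sde_solution M F W T x0 f g X \<longleftrightarrow>
     is_ito_process M F W T x0 (\<lambda>s \<omega>. f (X s \<omega>)) (\<lambda>s \<omega>. g (X s \<omega>)) X"

definition euler_approximation ::
  "'a measure \<Rightarrow> (real \<Rightarrow> 'a measure) \<Rightarrow> (real \<Rightarrow> 'a \<Rightarrow> real^'m) \<Rightarrow> real \<Rightarrow> ('a \<Rightarrow> real^'p) \<Rightarrow>
   (real^'p \<Rightarrow> real^'p) \<Rightarrow> (real^'p \<Rightarrow> real^'m^'p) \<Rightarrow> real \<Rightarrow> (real \<Rightarrow> 'a \<Rightarrow> real^'p) \<Rightarrow> bool" where
  "euler_approximation M F W T x0 fh gh h Y \<longleftrightarrow>
     is_ito_process M F W T x0
       (\<lambda>s \<omega>. fh (Y (grid_floor h s) \<omega>)) (\<lambda>s \<omega>. gh (Y (grid_floor h s) \<omega>)) Y"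

text \<open>
  The processes live on \<open>[0, T]\<close>, so the infimum runs over \<open>t \<in> (0, T]\<close>; inserting
  \<open>T\<close> into the set expresses the minimum of \<open>T\<close> and the infimum, where the infimum of the
  empty set is \<open>\<infinity>\<close>.
\<close>

definition exit_time ::
  "real \<Rightarrow> (real \<Rightarrow> 'a \<Rightarrow> real^'p) \<Rightarrow> (real \<Rightarrow> 'a \<Rightarrow> real^'p) \<Rightarrow> real \<Rightarrow> 'a \<Rightarrow> real" where
  "exit_time T X E R \<omega> =
     Inf (insert T {t\<in>{0<..T}. norm (X t \<omega>) > R - 1 \<or> norm (E t \<omega>) > 1})"

end

theory Submission
  imports Defs
begin

text \<open>
  On \<open>{\<tau> = T}\<close> the error is dominated by its supremum up to \<open>\<tau>\<close>. On \<open>{\<tau> < T}\<close> continuity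
  of the paths gives \<open>norm (x \<tau>) \<ge> R - 1\<close> or \<open>norm (E \<tau>) \<ge> 1\<close>, so Markov's inequality bounds
  \<open>P(\<tau> < T)\<close> by \<open>C / \<phi> (R - 1)\<close> plus the localized error. The interpolation
  \<open>z\<^sup>\<theta> \<le> d\<^sup>\<theta> + d\<^sup>\<theta>\<^sup>-\<^sup>p z\<^sup>p\<close>, with \<open>p = 2\<close>, \<open>d = \<delta>\<close> on the first event and \<open>p = q\<close>, \<open>d = 1 / \<delta>\<close> on the second,
  then bounds the \<open>\<theta>\<close>-th moment of the error uniformly in \<open>t\<close>; let \<open>h\<close> tend to 0, then \<open>\<delta>\<close>.
\<close>

section \<open>Elementary inequalities for real powers\<close>

text \<open>Up to the threshold \<open>d\<close> the first term suffices. Above it,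
  \<open>\<theta> - p\<close> is nonpositive, so replacing \<open>z\<close> by the smaller
  \<open>d\<close> in \<open>z powr (\<theta> - p)\<close> only increases that factor. The free
  parameter \<open>d\<close> later balances a lower moment against a higher one.\<close>

lemma powr_interpolation:
  fixes z d \<theta> p :: real
  assumes "z \<ge> 0" "d > 0" "0 \<le> \<theta>" "\<theta> \<le> p"
  shows "z powr \<theta> \<le> d powr \<theta> + d powr (\<theta> - p) * z powr p"
proof (cases "z \<le> d")
  case True
  then have "z powr \<theta> \<le> d powr \<theta>"
    using assms by (simp add: powr_mono2)
  then show ?thesis
    by (smt (verit) mult_nonneg_nonneg powr_ge_zero)
next
  case False
  then have "z powr \<theta> = z powr (\<theta> - p) * z powr p"
    by (simp flip: powr_add)
  also have "\<dots> \<le> d powr (\<theta> - p) * z powr p"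
    using False assms by (intro mult_right_mono powr_mono2') auto
  finally show ?thesis
    by (smt (verit) powr_ge_zero)
qed

text \<open>Passing through twice the larger norm avoids convexity, so exponents below 1 are covered
  as well.\<close>

lemma norm_diff_powr_le:
  fixes a b :: "'v::real_normed_vector"
  assumes "q \<ge> 0"
  shows "norm (a - b) powr q \<le> 2 powr q * (norm a powr q + norm b powr q)"
proof -
  have "norm (a - b) \<le> 2 * max (norm a) (norm b)"
    using norm_triangle_ineq4[of a b] by linarith
  then have "norm (a - b) powr q \<le> (2 * max (norm a) (norm b)) powr q"
    using assms by (intro powr_mono2) auto
  also have "\<dots> = 2 powr q * max (norm a) (norm b) powr q"
    by (simp add: powr_mult)
  also have "\<dots> \<le> 2 powr q * (norm a powr q + norm b powr q)"
    by (intro mult_left_mono) (auto simp: max_def)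
  finally show ?thesis .
qed

section \<open>Continuous processes sampled at a random time\<close>

text \<open>Rounding \<open>\<sigma>\<close> to a grid of mesh \<open>1 / Suc n\<close> gives a time
  with countably many values, where measurability can be checked value by value; continuity of the
  paths then passes to the limit. Since only measurability with respect to \<open>M\<close> is
  claimed, rounding down is harmless, although the rounded time need not be a stopping time.\<close>

lemma borel_measurable_at_random_time:
  fixes V :: "real \<Rightarrow> 'a \<Rightarrow> 'v::metric_space"
  assumes V: "\<And>t. t \<in> {0..T} \<Longrightarrow> V t \<in> borel_measurable M"
    and cont: "\<And>\<omega>. \<omega> \<in> space M \<Longrightarrow> continuous_on {0..T} (\<lambda>t. V t \<omega>)"
    and \<sigma>: "\<sigma> \<in> borel_measurable M"
    and range: "\<And>\<omega>. \<omega> \<in> space M \<Longrightarrow> \<sigma> \<omega> \<in> {0..T}"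
  shows "(\<lambda>\<omega>. V (\<sigma> \<omega>) \<omega>) \<in> borel_measurable M"
proof (rule borel_measurable_LIMSEQ_metric)
  \<comment> \<open>The grid points are clamped to \<open>{0..T}\<close> so that
    \<open>V (c n i)\<close> is measurable for every integer \<open>i\<close>, not only for those
    that occur.\<close>
  define c :: "nat \<Rightarrow> int \<Rightarrow> real"
    where "c n i = max 0 (min T (real_of_int i / real (Suc n)))" for n i
  show "(\<lambda>\<omega>. V (c n \<lfloor>real (Suc n) * \<sigma> \<omega>\<rfloor>) \<omega>) \<in> borel_measurable M" for n
  proof (cases "T \<ge> 0")
    case True
    show ?thesis
    proof (rule measurable_compose_countable)
      show "V (c n i) \<in> borel_measurable M" for i
        using True by (intro V) (auto simp: c_def)
      show "(\<lambda>\<omega>. \<lfloor>real (Suc n) * \<sigma> \<omega>\<rfloor>) \<in> measurable M (count_space UNIV)"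
        using \<sigma> by measurable
    qed
  next
    \<comment> \<open>For negative \<open>T\<close> the range condition on \<open>\<sigma>\<close>
      leaves no outcome at all.\<close>
    case False
    then have "space M = {}"
      using range by force
    then show ?thesis
      by (simp add: measurable_def)
  qed
  fix \<omega> assume \<omega>: "\<omega> \<in> space M"
  \<comment> \<open>Clamping keeps both bounds because \<open>\<sigma> \<omega>\<close> itself lies
    in \<open>{0..T}\<close>.\<close>
  have bounds: "\<sigma> \<omega> - 1 / real (Suc n) \<le> c n \<lfloor>real (Suc n) * \<sigma> \<omega>\<rfloor> \<and>
      c n \<lfloor>real (Suc n) * \<sigma> \<omega>\<rfloor> \<le> \<sigma> \<omega>" for n
  proof -
    define N where "N = real (Suc n)"
    have "N > 0" by (simp add: N_def)
    moreover have "\<lfloor>N * \<sigma> \<omega>\<rfloor> \<le> N * \<sigma> \<omega>" "N * \<sigma> \<omega> - 1 \<le> \<lfloor>N * \<sigma> \<omega>\<rfloor>"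
      by linarith+
    ultimately have "\<lfloor>N * \<sigma> \<omega>\<rfloor> / N \<le> N * \<sigma> \<omega> / N" "(N * \<sigma> \<omega> - 1) / N \<le> \<lfloor>N * \<sigma> \<omega>\<rfloor> / N"
      by (simp_all only: divide_right_mono less_imp_le)
    then have "\<lfloor>N * \<sigma> \<omega>\<rfloor> / N \<le> \<sigma> \<omega>" "\<sigma> \<omega> - 1 / N \<le> \<lfloor>N * \<sigma> \<omega>\<rfloor> / N"
      using \<open>N > 0\<close> by (simp_all add: diff_divide_distrib)
    then show ?thesis
      using range[OF \<omega>] unfolding c_def N_def by auto
  qed
  have "(\<lambda>n. c n \<lfloor>real (Suc n) * \<sigma> \<omega>\<rfloor>) \<longlonglongrightarrow> \<sigma> \<omega>"
  proof (rule tendsto_sandwich)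
    show "(\<lambda>n. \<sigma> \<omega> - 1 / real (Suc n)) \<longlonglongrightarrow> \<sigma> \<omega>"
      using tendsto_diff[OF tendsto_const[of "\<sigma> \<omega>"] LIMSEQ_Suc[OF lim_1_over_n]] by simp
  qed (use bounds in auto)
  moreover have "c n \<lfloor>real (Suc n) * \<sigma> \<omega>\<rfloor> \<in> {0..T}" for n
    using range[OF \<omega>] by (auto simp: c_def)
  ultimately show "(\<lambda>n. V (c n \<lfloor>real (Suc n) * \<sigma> \<omega>\<rfloor>) \<omega>) \<longlonglongrightarrow> V (\<sigma> \<omega>) \<omega>"
    using range[OF \<omega>] by (intro continuous_on_tendsto_compose[OF cont[OF \<omega>]]) auto
qed

section \<open>Exit times: range, measurability and behaviour at the exit\<close>

lemma exit_time_in_interval: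
  assumes "T > 0"
  shows "exit_time T X D r \<omega> \<in> {0..T}"
  unfolding exit_time_def atLeastAtMost_iff
  using assms by (intro conjI cInf_greatest cInf_lower bdd_belowI[of _ 0]) auto

text \<open>An infimum lies strictly below \<open>a\<close> exactly when some element does. As
  \<open>a \<le> T\<close>, the inserted point \<open>T\<close> is never such an element, and the
  constraint \<open>t \<le> T\<close> is automatic.\<close>

lemma exit_time_less_iff:
  assumes "T > 0" "a \<le> T"
  shows "exit_time T X D r \<omega> < a \<longleftrightarrow>
    (\<exists>t\<in>{0<..<a}. norm (X t \<omega>) > r - 1 \<or> norm (D t \<omega>) > 1)"
proof -
  have "bdd_below (insert T {t\<in>{0<..T}. norm (X t \<omega>) > r - 1 \<or> norm (D t \<omega>) > 1})"
    by (rule bdd_belowI[of _ 0]) (use assms in auto)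
  then show ?thesis
    unfolding exit_time_def using assms by (subst cInf_less_iff) auto
qed

text \<open>The exit conditions are strict, so along a continuous path they hold on a relatively
  open set of times. Existence of an exit before \<open>a\<close> can therefore be tested at
  rational times, which yields a countable union of events.\<close>

lemma exit_time_measurable:
  fixes X D :: "real \<Rightarrow> 'a \<Rightarrow> real^'p"
  assumes T: "T > 0"
    and X: "\<And>t. t \<in> {0..T} \<Longrightarrow> X t \<in> borel_measurable M"
    and D: "\<And>t. t \<in> {0..T} \<Longrightarrow> D t \<in> borel_measurable M"
    and cont_X: "\<And>\<omega>. \<omega> \<in> space M \<Longrightarrow> continuous_on {0..T} (\<lambda>t. X t \<omega>)"
    and cont_D: "\<And>\<omega>. \<omega> \<in> space M \<Longrightarrow> continuous_on {0..T} (\<lambda>t. D t \<omega>)"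
  shows "exit_time T X D r \<in> borel_measurable M"
proof (rule borel_measurableI_less)
  fix a :: real
  show "{\<omega> \<in> space M. exit_time T X D r \<omega> < a} \<in> sets M"
  proof (cases "a \<le> T")
    case False
    then have "{\<omega> \<in> space M. exit_time T X D r \<omega> < a} = space M"
      using exit_time_in_interval[OF T, of X D r] by (auto intro: le_less_trans[of _ T])
    then show ?thesis by simp
  next
    case True
    let ?P = "\<lambda>t \<omega>. norm (X t \<omega>) > r - 1 \<or> norm (D t \<omega>) > 1"
    have "(\<exists>t\<in>{0<..<a}. ?P t \<omega>) \<longleftrightarrow> (\<exists>t\<in>\<rat> \<inter> {0<..<a}. ?P t \<omega>)" if \<omega>: "\<omega> \<in> space M" for \<omega>
    proof
      assume "\<exists>t\<in>{0<..<a}. ?P t \<omega>"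
      then obtain t where t: "t \<in> {0<..<a}" "?P t \<omega>" by blast
      have sub: "{0<..<a} \<subseteq> {0..T}" using True by auto
      \<comment> \<open>\<open>U\<close> collects the exits before \<open>a\<close>; restricting to
        the open interval makes it open in the whole real line, so it contains a rational near each
        of its points.\<close>
      define U where "U = {0<..<a} \<inter> (\<lambda>t. norm (X t \<omega>)) -` {r - 1<..} \<union>
        {0<..<a} \<inter> (\<lambda>t. norm (D t \<omega>)) -` {1<..}"
      have "open U"
        unfolding U_def
        by (intro open_Un continuous_open_preimage continuous_on_norm
            continuous_on_subset[OF cont_X[OF \<omega>] sub] continuous_on_subset[OF cont_D[OF \<omega>] sub])
          auto
      moreover have "t \<in> U" using t by (auto simp: U_def)
      ultimately obtain e where e: "e > 0" "ball t e \<subseteq> U"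
        by (auto simp: open_contains_ball)
      obtain s where s: "s \<in> \<rat>" "t < s" "s < t + e"
        using Rats_dense_in_real[of t "t + e"] e by auto
      then have "s \<in> U" using e by (auto simp: dist_real_def)
      then show "\<exists>t\<in>\<rat> \<inter> {0<..<a}. ?P t \<omega>"
        using s by (auto simp: U_def)
    qed auto
    then have "{\<omega> \<in> space M. exit_time T X D r \<omega> < a} =
        (\<Union>t\<in>\<rat> \<inter> {0<..<a}. {\<omega> \<in> space M. ?P t \<omega>})"
      by (auto simp: exit_time_less_iff[OF T True])
    also have "\<dots> \<in> sets M"
    proof (rule sets.countable_UN'')
      show "countable (\<rat> \<inter> {0<..<a})"
        by (simp add: countable_rat)
      show "{\<omega> \<in> space M. ?P t \<omega>} \<in> sets M" if "t \<in> \<rat> \<inter> {0<..<a}" for t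
      proof -
        have "t \<in> {0..T}" using that True by auto
        note [measurable] = X[OF this] D[OF this]
        show ?thesis by measurable
      qed
    qed
    finally show ?thesis .
  qed
qed

text \<open>If both norms were strictly below their thresholds at the exit time, continuity would
  keep them there for a short while, and the infimum would be larger. Only weak inequalities
  survive, because the infimum need not be attained.\<close>

lemma exit_time_exits:
  fixes X D :: "real \<Rightarrow> 'a \<Rightarrow> real^'p"
  assumes T: "T > 0"
    and cont_X: "continuous_on {0..T} (\<lambda>t. X t \<omega>)"
    and cont_D: "continuous_on {0..T} (\<lambda>t. D t \<omega>)"
    and less: "exit_time T X D r \<omega> < T"
  shows "norm (X (exit_time T X D r \<omega>) \<omega>) \<ge> r - 1 \<or> norm (D (exit_time T X D r \<omega>) \<omega>) \<ge> 1"
proof (rule ccontr)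
  let ?\<sigma> = "exit_time T X D r \<omega>"
  assume neg: "\<not> ?thesis"
  have \<sigma>: "?\<sigma> \<in> {0..T}" by (rule exit_time_in_interval[OF T])
  have lim: "((\<lambda>t. X t \<omega>) \<longlongrightarrow> X ?\<sigma> \<omega>) (at ?\<sigma> within {0..T})"
    "((\<lambda>t. D t \<omega>) \<longlongrightarrow> D ?\<sigma> \<omega>) (at ?\<sigma> within {0..T})"
    using cont_X cont_D \<sigma> by (auto simp: continuous_on_def)
  have "eventually (\<lambda>t. norm (X t \<omega>) < r - 1 \<and> norm (D t \<omega>) < 1) (at ?\<sigma> within {0..T})"
    using neg by (intro eventually_conj order_tendstoD(2)[OF tendsto_norm[OF lim(1)]]
      order_tendstoD(2)[OF tendsto_norm[OF lim(2)]]) auto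
  then obtain d where d: "d > 0"
    "\<And>t. t \<in> {0..T} \<Longrightarrow> t \<noteq> ?\<sigma> \<Longrightarrow> dist t ?\<sigma> < d \<Longrightarrow>
      norm (X t \<omega>) < r - 1 \<and> norm (D t \<omega>) < 1"
    unfolding eventually_at by blast
  \<comment> \<open>This level lies just past the exit time, within the neighbourhood where
    continuity controls both norms, and is capped at \<open>T\<close> so that
    \<open>exit_time_less_iff\<close> applies. The resulting exit \<open>t\<close> is then excluded
    to the right of, at, and to the left of the exit time.\<close>
  define a where "a = min T (?\<sigma> + d)"
  have "?\<sigma> < a" "a \<le> T" using less d by (auto simp: a_def)
  then obtain t where t: "t \<in> {0<..<a}" "norm (X t \<omega>) > r - 1 \<or> norm (D t \<omega>) > 1"
    using exit_time_less_iff[OF T, of a X D r \<omega>] by blast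
  have "\<not> ?\<sigma> < t"
  proof
    assume "?\<sigma> < t"
    then show False
      using d(2)[of t] t by (auto simp: a_def dist_real_def)
  qed
  moreover have "t \<noteq> ?\<sigma>" using t(2) neg by auto
  ultimately have "t < ?\<sigma>" by simp
  moreover have "?\<sigma> < T" by fact
  \<comment> \<open>An exit strictly before \<open>?\<sigma>\<close> would, with \<open>a\<close>
    taken to be \<open>?\<sigma>\<close> itself, make the exit time smaller than itself.\<close>
  ultimately show False
    using exit_time_less_iff[OF T, of ?\<sigma> X D r \<omega>] t by auto
qed

section \<open>Markov's inequality and splitting of a moment along an event\<close>

text \<open>This is Markov's inequality for a monotone function: on the level set the integrand is
  at least the constant \<open>\<phi> a\<close>.\<close>

lemma emeasure_ge_le_divide:
  fixes Z :: "'a \<Rightarrow> real"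
  assumes Z: "Z \<in> borel_measurable M"
    and \<phi>: "mono_on {0..} \<phi>"
    and a: "a \<ge> 0" "\<phi> a > 0"
    and bound: "(\<integral>\<^sup>+\<omega>. ennreal (\<phi> (Z \<omega>)) \<partial>M) \<le> ennreal C"
  shows "emeasure M {\<omega> \<in> space M. Z \<omega> \<ge> a} \<le> ennreal (C / \<phi> a)"
proof -
  let ?S = "{\<omega> \<in> space M. Z \<omega> \<ge> a}"
  have [measurable]: "?S \<in> sets M" using Z by measurable
  have "ennreal (\<phi> a) * emeasure M ?S = (\<integral>\<^sup>+\<omega>. ennreal (\<phi> a) * indicator ?S \<omega> \<partial>M)"
    by (simp add: nn_integral_cmult_indicator)
  also have "\<dots> \<le> (\<integral>\<^sup>+\<omega>. ennreal (\<phi> (Z \<omega>)) \<partial>M)"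
    using a by (intro nn_integral_mono)
      (auto simp: indicator_def intro!: ennreal_leI mono_onD[OF \<phi>])
  also note bound
  finally have "ennreal (\<phi> a) * emeasure M ?S \<le> ennreal C" .
  then have "ennreal (1 / \<phi> a) * (ennreal (\<phi> a) * emeasure M ?S) \<le> ennreal (1 / \<phi> a) * ennreal C"
    by (rule mult_left_mono) simp
  then show ?thesis
    using a by (simp add: mult.assoc[symmetric] ennreal_mult'[symmetric])
qed

lemma is_ito_process_measurable:
  assumes "filtered_prob_space M F" "is_ito_process M F W T x0 b \<sigma> X" "t \<in> {0..T}"
  shows "X t \<in> borel_measurable M"
  using assms measurable_from_subalg[of M "F t" "X t" borel]
  unfolding filtered_prob_space_def is_ito_process_def by blast

lemma is_ito_process_continuous:
  assumes "is_ito_process M F W T x0 b \<sigma> X" "\<omega> \<in> space M"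
  shows "continuous_on {0..T} (\<lambda>t. X t \<omega>)"
  using assms by (auto simp: is_ito_process_def)

text \<open>Off \<open>A\<close> the power is interpolated against the square with threshold
  \<open>d\<close>; on \<open>A\<close> only the \<open>q\<close>-th moments are available, so it is
  interpolated against the power \<open>q\<close> with threshold \<open>k\<close>, at the price of
  \<open>emeasure M A\<close>.\<close>

lemma nn_integral_powr_split_le:
  fixes u v :: "'a \<Rightarrow> 'v::{second_countable_topology, real_normed_vector}"
  assumes [measurable]: "A \<in> sets M" "u \<in> borel_measurable M" "v \<in> borel_measurable M"
    and mass: "emeasure M (space M) = 1"
    and d: "d > 0" and k: "k > 0" and \<theta>: "0 < \<theta>" "\<theta> \<le> 2" "\<theta> \<le> q"
    and off: "(\<integral>\<^sup>+\<omega>. ennreal ((norm (u \<omega> - v \<omega>))\<^sup>2) * indicator (space M - A) \<omega> \<partial>M) \<le> e"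
    and mom: "(\<integral>\<^sup>+\<omega>. ennreal (norm (u \<omega>) powr q) \<partial>M) + (\<integral>\<^sup>+\<omega>. ennreal (norm (v \<omega>) powr q) \<partial>M) \<le> c"
  shows "(\<integral>\<^sup>+\<omega>. ennreal (norm (u \<omega> - v \<omega>) powr \<theta>) \<partial>M) \<le>
    ennreal (d powr \<theta>) + ennreal (d powr (\<theta> - 2)) * e
    + ennreal (k powr \<theta>) * emeasure M A + ennreal (k powr (\<theta> - q) * 2 powr q) * c"
proof -
  let ?z = "\<lambda>\<omega>. norm (u \<omega> - v \<omega>)"
  let ?w = "\<lambda>\<omega>. ennreal (norm (u \<omega>) powr q) + ennreal (norm (v \<omega>) powr q)"
  \<comment> \<open>All four terms are kept on both sides of the split: those belonging to the other
    case are nonnegative, and the sum can be integrated term by term.\<close>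
  have "ennreal (?z \<omega> powr \<theta>) \<le> ennreal (d powr \<theta>)
      + ennreal (d powr (\<theta> - 2)) * (ennreal ((?z \<omega>)\<^sup>2) * indicator (space M - A) \<omega>)
      + ennreal (k powr \<theta>) * indicator A \<omega>
      + ennreal (k powr (\<theta> - q) * 2 powr q) * ?w \<omega>" if "\<omega> \<in> space M" for \<omega>
  proof (cases "\<omega> \<in> A")
    case True
    have "?z \<omega> powr \<theta> \<le> k powr \<theta> + k powr (\<theta> - q) * ?z \<omega> powr q"
      using k \<theta> by (intro powr_interpolation) auto
    also have "\<dots> \<le> k powr \<theta> + k powr (\<theta> - q) * (2 powr q * (norm (u \<omega>) powr q + norm (v \<omega>) powr q))"
      using \<theta> by (intro add_left_mono mult_left_mono norm_diff_powr_le) auto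
    finally have "ennreal (?z \<omega> powr \<theta>) \<le> ennreal (k powr \<theta>)
        + ennreal (k powr (\<theta> - q) * 2 powr q) * ?w \<omega>"
      by (simp add: ennreal_leI mult.assoc flip: ennreal_plus ennreal_mult')
    then show ?thesis
      using True by (simp add: add.assoc add_increasing)
  next
    case False
    have "?z \<omega> powr \<theta> \<le> d powr \<theta> + d powr (\<theta> - 2) * ?z \<omega> powr 2"
      using d \<theta> by (intro powr_interpolation) auto
    then have "ennreal (?z \<omega> powr \<theta>) \<le> ennreal (d powr \<theta>)
        + ennreal (d powr (\<theta> - 2)) * ennreal ((?z \<omega>)\<^sup>2)"
      by (simp add: ennreal_leI flip: ennreal_plus ennreal_mult')
    then show ?thesis
      using False that by (simp add: add_increasing2)
  qed
  then have "(\<integral>\<^sup>+\<omega>. ennreal (?z \<omega> powr \<theta>) \<partial>M) \<le> (\<integral>\<^sup>+\<omega>. ennreal (d powr \<theta>)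
      + ennreal (d powr (\<theta> - 2)) * (ennreal ((?z \<omega>)\<^sup>2) * indicator (space M - A) \<omega>)
      + ennreal (k powr \<theta>) * indicator A \<omega>
      + ennreal (k powr (\<theta> - q) * 2 powr q) * ?w \<omega> \<partial>M)"
    by (rule nn_integral_mono)
  also have "\<dots> = ennreal (d powr \<theta>)
      + ennreal (d powr (\<theta> - 2)) * (\<integral>\<^sup>+\<omega>. ennreal ((?z \<omega>)\<^sup>2) * indicator (space M - A) \<omega> \<partial>M)
      + ennreal (k powr \<theta>) * emeasure M A
      + ennreal (k powr (\<theta> - q) * 2 powr q)
        * ((\<integral>\<^sup>+\<omega>. ennreal (norm (u \<omega>) powr q) \<partial>M) + (\<integral>\<^sup>+\<omega>. ennreal (norm (v \<omega>) powr q) \<partial>M))"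
    by (simp add: nn_integral_add nn_integral_cmult mass)
  also have "\<dots> \<le> ennreal (d powr \<theta>) + ennreal (d powr (\<theta> - 2)) * e
      + ennreal (k powr \<theta>) * emeasure M A + ennreal (k powr (\<theta> - q) * 2 powr q) * c"
    by (intro add_mono mult_left_mono off mom) auto
  finally show ?thesis .
qed

section \<open>Convergence of the error moments\<close>

theorem theorem2:
  fixes M :: "'a measure" and F :: "real \<Rightarrow> 'a measure"
    and W :: "real \<Rightarrow> 'a \<Rightarrow> real^'m"
    and f :: "real^'p \<Rightarrow> real^'p" and g :: "real^'p \<Rightarrow> real^'m^'p"
    and f\<^sub>h :: "real \<Rightarrow> real^'p \<Rightarrow> real^'p" and g\<^sub>h :: "real \<Rightarrow> real^'p \<Rightarrow> real^'m^'p"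
    and C\<^sub>a :: "real \<Rightarrow> real \<Rightarrow> real" and L B :: "real \<Rightarrow> real"
    and x0 :: "'a \<Rightarrow> real^'p"
    and x :: "real \<Rightarrow> 'a \<Rightarrow> real^'p" and Y E :: "real \<Rightarrow> real \<Rightarrow> 'a \<Rightarrow> real^'p"
    and \<tau> :: "real \<Rightarrow> real \<Rightarrow> 'a \<Rightarrow> real"
    and R \<phi> :: "real \<Rightarrow> real"
    and T C C' q \<theta> :: real
  assumes T: "T > 0"
    and space: "filtered_prob_space M F"
    and W: "standard_brownian_motion M F W"
    and lipschitz_h: "\<And>h r. h \<in> {0<..<1} \<Longrightarrow> r > 0 \<Longrightarrow>
          (\<exists>K. K-lipschitz_on (ball 0 r) (f\<^sub>h h)) \<and> (\<exists>K. K-lipschitz_on (ball 0 r) (g\<^sub>h h))"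
    and mono_Ca: "\<And>h. h \<in> {0<..<1} \<Longrightarrow> mono_on {0<..} (\<lambda>r. C\<^sub>a r h)"
    and mono_L: "mono_on {0<..} L"
    and mono_B: "mono_on {0<..} B"
    and approx: "\<And>h r u. h \<in> {0<..<1} \<Longrightarrow> r > 0 \<Longrightarrow> norm u < r \<Longrightarrow>
          norm (f\<^sub>h h u - f u) \<le> C\<^sub>a r h \<and> norm (g\<^sub>h h u - g u) \<le> C\<^sub>a r h"
    and Ca_tendsto: "\<And>r. r > 0 \<Longrightarrow> (C\<^sub>a r \<longlongrightarrow> 0) (at_right 0)"
    and lipschitz: "\<And>r u v. r > 0 \<Longrightarrow> norm u < r \<Longrightarrow> norm v < r \<Longrightarrow>
          norm (f u - f v) \<le> L r * norm (u - v) \<and> norm (g u - g v) \<le> L r * norm (u - v)"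
    and bounded: "\<And>h r u. h \<in> {0<..<1} \<Longrightarrow> r > 0 \<Longrightarrow> norm u < r \<Longrightarrow>
          norm (f\<^sub>h h u) \<le> B r \<and> norm (g\<^sub>h h u) \<le> B r"
    and x0: "x0 \<in> borel_measurable (F 0)"
    and x: "sde_solution M F W T x0 f g x"
    and Y: "\<And>h. h \<in> {0<..<1} \<Longrightarrow> euler_approximation M F W T x0 (f\<^sub>h h) (g\<^sub>h h) h (Y h)"
    and E: "E = (\<lambda>h t \<omega>. x t \<omega> - Y h t \<omega>)"
    and \<tau>: "\<tau> = (\<lambda>r h. exit_time T x (E h) r)"
    and R_pos: "\<And>h. h \<in> {0<..<1} \<Longrightarrow> R h > 0"
    and R_lim: "filterlim R at_top (at_right 0)"
    and local_conv: "((\<lambda>h. \<integral>\<^sup>+\<omega>. (SUP t\<in>{0..\<tau> (R h) h \<omega>}. ennreal ((norm (E h t \<omega>))\<^sup>2)) \<partial>M)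
          \<longlongrightarrow> 0) (at_right 0)"
    and \<phi>_nonneg: "\<And>z. z \<ge> 0 \<Longrightarrow> \<phi> z \<ge> 0"
    and \<phi>_mono: "mono_on {0..} \<phi>"
    and \<phi>_lim: "filterlim \<phi> at_top at_top"
    and \<phi>_bound: "\<And>h. h \<in> {0<..<1} \<Longrightarrow>
          (\<integral>\<^sup>+\<omega>. ennreal (\<phi> (norm (x (\<tau> (R h) h \<omega>) \<omega>))) \<partial>M) \<le> ennreal C"
    and q: "q > 0"
    and moments: "\<And>h. h \<in> {0<..<1} \<Longrightarrow>
          (SUP t\<in>{0..T}. \<integral>\<^sup>+\<omega>. ennreal (norm (x t \<omega>) powr q) \<partial>M)
          + (SUP t\<in>{0..T}. \<integral>\<^sup>+\<omega>. ennreal (norm (Y h t \<omega>) powr q) \<partial>M) \<le> ennreal C'"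
    and \<theta>: "\<theta> \<in> {0<..<q} \<inter> {0<..2}"
  shows "((\<lambda>h. SUP t\<in>{0..T}. \<integral>\<^sup>+\<omega>. ennreal (norm (E h t \<omega>) powr \<theta>) \<partial>M) \<longlongrightarrow> 0) (at_right 0)"
proof -
  define e where "e h = (\<integral>\<^sup>+\<omega>. (SUP t\<in>{0..\<tau> (R h) h \<omega>}. ennreal ((norm (E h t \<omega>))\<^sup>2)) \<partial>M)" for h
  interpret prob_space M
    using space by (simp add: filtered_prob_space_def)
  have x_meas: "x t \<in> borel_measurable M" if "t \<in> {0..T}" for t
    using is_ito_process_measurable[OF space _ that] x by (auto simp: sde_solution_def)
  have x_cont: "continuous_on {0..T} (\<lambda>t. x t \<omega>)" if "\<omega> \<in> space M" for \<omega>
    using is_ito_process_continuous[OF _ that] x by (auto simp: sde_solution_def)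
  have Y_meas: "Y h t \<in> borel_measurable M" if "h \<in> {0<..<1}" "t \<in> {0..T}" for h t
    using is_ito_process_measurable[OF space _ that(2)] Y[OF that(1)]
    by (auto simp: euler_approximation_def)
  have Y_cont: "continuous_on {0..T} (\<lambda>t. Y h t \<omega>)" if "h \<in> {0<..<1}" "\<omega> \<in> space M" for h \<omega>
    using is_ito_process_continuous[OF _ that(2)] Y[OF that(1)]
    by (auto simp: euler_approximation_def)

  \<comment> \<open>A single parameter \<open>d\<close> sets both thresholds, \<open>d\<close> off
    the early-exit event and \<open>1 / d\<close> on it. The coefficients of \<open>e h\<close> and
    of the probability bound may blow up for small \<open>d\<close>, but they are fixed while
    \<open>h\<close> tends to 0. The condition \<open>R h \<ge> 1\<close> keeps
    \<open>R h - 1\<close> in the domain where \<open>\<phi>\<close> is monotone.\<close>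
  have bound: "(SUP t\<in>{0..T}. \<integral>\<^sup>+\<omega>. ennreal (norm (E h t \<omega>) powr \<theta>) \<partial>M) \<le>
      ennreal (d powr \<theta>) + ennreal (d powr (\<theta> - 2)) * e h
      + ennreal ((1 / d) powr \<theta>) * (ennreal (C / \<phi> (R h - 1)) + e h)
      + ennreal ((1 / d) powr (\<theta> - q) * 2 powr q) * ennreal C'"
    if h: "h \<in> {0<..<1}" and d: "d > 0" and R: "R h \<ge> 1" "\<phi> (R h - 1) > 0" for h d
  proof -
    define \<sigma> where "\<sigma> = exit_time T x (E h) (R h)"
    have \<sigma>_eq: "\<tau> (R h) h = \<sigma>"
      by (simp add: \<tau> \<sigma>_def fun_eq_iff)
    have \<sigma>_range: "\<sigma> \<omega> \<in> {0..T}" for \<omega>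
      unfolding \<sigma>_def by (rule exit_time_in_interval[OF T])
    have E_meas: "E h t \<in> borel_measurable M" if "t \<in> {0..T}" for t
      unfolding E using x_meas[OF that] Y_meas[OF h that] by measurable
    have E_cont: "continuous_on {0..T} (\<lambda>t. E h t \<omega>)" if "\<omega> \<in> space M" for \<omega>
      unfolding E using x_cont[OF that] Y_cont[OF h that] by (intro continuous_intros)
    have \<sigma>_meas [measurable]: "\<sigma> \<in> borel_measurable M"
      unfolding \<sigma>_def by (rule exit_time_measurable[OF T x_meas E_meas x_cont E_cont])
    have [measurable]: "(\<lambda>\<omega>. x (\<sigma> \<omega>) \<omega>) \<in> borel_measurable M"
      "(\<lambda>\<omega>. E h (\<sigma> \<omega>) \<omega>) \<in> borel_measurable M"
      by (rule borel_measurable_at_random_time[OF x_meas x_cont \<sigma>_meas \<sigma>_range]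
          borel_measurable_at_random_time[OF E_meas E_cont \<sigma>_meas \<sigma>_range]; assumption)+
    \<comment> \<open>The random supremum is only compared pointwise: with the error at
      \<open>\<sigma>\<close> on \<open>S\<^sub>E\<close>, and with the error at a fixed time off
      \<open>A\<close>.\<close>
    have sup: "ennreal ((norm (E h t \<omega>))\<^sup>2) \<le> (SUP t\<in>{0..\<tau> (R h) h \<omega>}. ennreal ((norm (E h t \<omega>))\<^sup>2))"
      if "t \<in> {0..\<sigma> \<omega>}" for t \<omega>
      using that by (intro SUP_upper) (simp add: \<sigma>_eq)
    define A where "A = {\<omega> \<in> space M. \<sigma> \<omega> < T}"
    define S\<^sub>x where "S\<^sub>x = {\<omega> \<in> space M. norm (x (\<sigma> \<omega>) \<omega>) \<ge> R h - 1}"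
    define S\<^sub>E where "S\<^sub>E = {\<omega> \<in> space M. norm (E h (\<sigma> \<omega>) \<omega>) \<ge> 1}"
    have [measurable]: "A \<in> sets M" "S\<^sub>x \<in> sets M" "S\<^sub>E \<in> sets M"
      unfolding A_def S\<^sub>x_def S\<^sub>E_def by measurable
    have "emeasure M S\<^sub>x \<le> ennreal (C / \<phi> (R h - 1))"
      unfolding S\<^sub>x_def using R \<phi>_bound[OF h]
      by (intro emeasure_ge_le_divide[OF _ \<phi>_mono]) (auto simp: \<sigma>_eq)
    moreover have "emeasure M S\<^sub>E \<le> e h"
    proof -
      have "emeasure M S\<^sub>E = (\<integral>\<^sup>+\<omega>. indicator S\<^sub>E \<omega> \<partial>M)"
        by simp
      also have "\<dots> \<le> e h"
        unfolding e_def
      proof (rule nn_integral_mono)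
        fix \<omega>
        \<comment> \<open>On \<open>S\<^sub>E\<close> the squared error at the exit time is at least
          1, so it dominates the indicator.\<close>
        have "indicator S\<^sub>E \<omega> \<le> ennreal ((norm (E h (\<sigma> \<omega>) \<omega>))\<^sup>2)"
          by (auto simp: S\<^sub>E_def indicator_def one_le_power simp flip: ennreal_1 intro!: ennreal_leI)
        also have "\<dots> \<le> (SUP t\<in>{0..\<tau> (R h) h \<omega>}. ennreal ((norm (E h t \<omega>))\<^sup>2))"
          using \<sigma>_range[of \<omega>] by (intro sup) auto
        finally show "indicator S\<^sub>E \<omega> \<le> \<dots>" .
      qed
      finally show ?thesis .
    qed
    moreover have "A \<subseteq> S\<^sub>x \<union> S\<^sub>E"
    proof
      fix \<omega> assume "\<omega> \<in> A"
      then have "\<omega> \<in> space M" "exit_time T x (E h) (R h) \<omega> < T"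
        by (auto simp: A_def \<sigma>_def)
      then show "\<omega> \<in> S\<^sub>x \<union> S\<^sub>E"
        using exit_time_exits[where X = x and D = "E h" and \<omega> = \<omega>, OF T x_cont E_cont] by (auto simp: S\<^sub>x_def S\<^sub>E_def \<sigma>_def)
    qed
    ultimately have A_le: "emeasure M A \<le> ennreal (C / \<phi> (R h - 1)) + e h"
      by (meson add_mono emeasure_mono emeasure_subadditive order_trans
          \<open>S\<^sub>x \<in> sets M\<close> \<open>S\<^sub>E \<in> sets M\<close> sets.Un)
    show ?thesis
    proof (rule SUP_least)
      fix t assume t: "t \<in> {0..T}"
      note [measurable] = x_meas[OF t] Y_meas[OF h t]
      \<comment> \<open>Off \<open>A\<close> the exit time equals \<open>T\<close>, so every
        \<open>t\<close> in \<open>{0..T}\<close> is covered by the localized supremum.\<close>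
      have "(\<integral>\<^sup>+\<omega>. ennreal ((norm (x t \<omega> - Y h t \<omega>))\<^sup>2) * indicator (space M - A) \<omega> \<partial>M) \<le> e h"
        unfolding e_def
      proof (rule nn_integral_mono)
        fix \<omega>
        show "ennreal ((norm (x t \<omega> - Y h t \<omega>))\<^sup>2) * indicator (space M - A) \<omega>
            \<le> (SUP t\<in>{0..\<tau> (R h) h \<omega>}. ennreal ((norm (E h t \<omega>))\<^sup>2))"
          using sup[of t \<omega>] t \<sigma>_range[of \<omega>]
          by (cases "\<omega> \<in> space M - A") (auto simp: A_def E)
      qed
      moreover have "(\<integral>\<^sup>+\<omega>. ennreal (norm (x t \<omega>) powr q) \<partial>M)
          + (\<integral>\<^sup>+\<omega>. ennreal (norm (Y h t \<omega>) powr q) \<partial>M) \<le> ennreal C'"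
        by (rule order_trans[OF add_mono moments[OF h]]) (rule SUP_upper[OF t])+
      ultimately have "(\<integral>\<^sup>+\<omega>. ennreal (norm (E h t \<omega>) powr \<theta>) \<partial>M) \<le>
          ennreal (d powr \<theta>) + ennreal (d powr (\<theta> - 2)) * e h
          + ennreal ((1 / d) powr \<theta>) * emeasure M A
          + ennreal ((1 / d) powr (\<theta> - q) * 2 powr q) * ennreal C'"
        unfolding E using d \<theta>
        by (intro nn_integral_powr_split_le) (auto simp: emeasure_space_1)
      also have "\<dots> \<le> ennreal (d powr \<theta>) + ennreal (d powr (\<theta> - 2)) * e h
          + ennreal ((1 / d) powr \<theta>) * (ennreal (C / \<phi> (R h - 1)) + e h)
          + ennreal ((1 / d) powr (\<theta> - q) * 2 powr q) * ennreal C'"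
        by (intro add_mono mult_left_mono A_le order_refl) auto
      finally show "(\<integral>\<^sup>+\<omega>. ennreal (norm (E h t \<omega>) powr \<theta>) \<partial>M) \<le> \<dots>" .
    qed
  qed

  have R_lim': "filterlim (\<lambda>h. R h - 1) at_top (at_right 0)"
    using filterlim_tendsto_add_at_top[OF tendsto_const[of "-1"] R_lim] by simp
  have \<phi>R_lim: "filterlim (\<lambda>h. \<phi> (R h - 1)) at_top (at_right 0)"
    by (rule filterlim_compose[OF \<phi>_lim R_lim'])
  have "((\<lambda>h. C / \<phi> (R h - 1)) \<longlongrightarrow> 0) (at_right 0)"
    by (rule real_tendsto_divide_at_top[OF tendsto_const \<phi>R_lim])
  then have C_lim: "((\<lambda>h. ennreal (C / \<phi> (R h - 1))) \<longlongrightarrow> 0) (at_right 0)"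
    using tendsto_ennrealI by fastforce
  have e_lim: "(e \<longlongrightarrow> 0) (at_right 0)"
    using local_conv by (simp add: e_def[abs_def])
  \<comment> \<open>The side conditions of \<open>bound\<close> hold for all sufficiently small
    \<open>h\<close>.\<close>
  have ev: "eventually (\<lambda>h. h \<in> {0<..<1} \<and> R h \<ge> 1 \<and> \<phi> (R h - 1) > 0) (at_right (0::real))"
    using eventually_at_right_real[OF zero_less_one] filterlim_at_top[THEN iffD1, OF R_lim, rule_format, of 1]
      filterlim_at_top_dense[THEN iffD1, OF \<phi>R_lim, rule_format, of 0]
    by eventually_elim auto

  show ?thesis
  proof (rule order_tendstoI)
    fix a :: ennreal assume a: "0 < a"
    have powr_lim: "((\<lambda>d::real. d powr r) \<longlongrightarrow> 0) (at_right 0)" if "r > 0" for r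
    proof -
      have "eventually (\<lambda>d::real. 0 \<le> d) (at_right 0)"
        by (rule eventually_mono[OF eventually_at_right_less]) simp
      from tendsto_powr2[OF tendsto_ident_at tendsto_const this that] show ?thesis
        using that by simp
    qed
    \<comment> \<open>These are the terms of \<open>bound\<close> that survive the limit in
      \<open>h\<close>. They vanish as \<open>d\<close> tends to 0 because \<open>\<theta>\<close>
      is positive and strictly below \<open>q\<close>, so some \<open>d\<close> brings them below
      \<open>a\<close>.\<close>
    have "((\<lambda>d. ennreal (d powr \<theta>) + ennreal C' * ennreal (d powr (q - \<theta>) * 2 powr q))
        \<longlongrightarrow> ennreal 0 + ennreal C' * ennreal (0 * 2 powr q)) (at_right 0)"
      using \<theta> by (intro tendsto_add ennreal_tendsto_cmult tendsto_ennrealI tendsto_mult powr_lim tendsto_const) auto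
    then have "eventually (\<lambda>d. ennreal (d powr \<theta>) + ennreal C' * ennreal (d powr (q - \<theta>) * 2 powr q) < a)
        (at_right 0)"
      by (rule order_tendstoD(2)) (use a in simp)
    then have "eventually (\<lambda>d. d > 0 \<and>
        ennreal (d powr \<theta>) + ennreal C' * ennreal (d powr (q - \<theta>) * 2 powr q) < a) (at_right 0)"
      by (rule eventually_conj[OF eventually_at_right_less])
    from eventually_happens'[OF trivial_limit_at_right_real this] obtain d :: real where d: "d > 0"
      and d_less: "ennreal (d powr \<theta>) + ennreal C' * ennreal (d powr (q - \<theta>) * 2 powr q) < a"
      by blast
    have inv: "(1 / d) powr (\<theta> - q) = d powr (q - \<theta>)"
      using d by (simp add: powr_divide flip: powr_minus_divide)
    \<comment> \<open>With \<open>d\<close> fixed, every coefficient is finite, so the terms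
      containing \<open>e h\<close> or \<open>C / \<phi> (R h - 1)\<close> tend to 0.\<close>
    have "((\<lambda>h. ennreal (d powr \<theta>) + ennreal (d powr (\<theta> - 2)) * e h
        + ennreal ((1 / d) powr \<theta>) * (ennreal (C / \<phi> (R h - 1)) + e h)
        + ennreal ((1 / d) powr (\<theta> - q) * 2 powr q) * ennreal C')
      \<longlongrightarrow> ennreal (d powr \<theta>) + ennreal (d powr (\<theta> - 2)) * 0
        + ennreal ((1 / d) powr \<theta>) * (0 + 0)
        + ennreal ((1 / d) powr (\<theta> - q) * 2 powr q) * ennreal C') (at_right 0)"
      by (intro tendsto_add ennreal_tendsto_cmult tendsto_const e_lim C_lim) auto
    then have "eventually (\<lambda>h. ennreal (d powr \<theta>) + ennreal (d powr (\<theta> - 2)) * e h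
        + ennreal ((1 / d) powr \<theta>) * (ennreal (C / \<phi> (R h - 1)) + e h)
        + ennreal ((1 / d) powr (\<theta> - q) * 2 powr q) * ennreal C' < a) (at_right 0)"
      by (rule order_tendstoD(2)) (use d_less in \<open>simp add: inv mult.commute\<close>)
    then show "eventually (\<lambda>h. (SUP t\<in>{0..T}. \<integral>\<^sup>+\<omega>. ennreal (norm (E h t \<omega>) powr \<theta>) \<partial>M) < a)
        (at_right 0)"
      using ev
    proof eventually_elim
      case (elim h)
      then show ?case
        using bound[of h d] d by (auto intro: le_less_trans)
    qed
  \<comment> \<open>The remaining half of the order criterion concerns levels below 0, of which
    \<open>ennreal\<close> has none.\<close>
  qed auto
qed

end
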